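(* Let $d=1$, $k=2$, $\xi\in\mathbb{R}$ with $\xi\neq0$, and let $c^2>0$, $b_1,b_2>0$ with $b_1\ne b_2$, and $a_1,a_2\in\mathbb{R}$ with $a_1a_2<0$. Let $$g(\lambda)=\lambda^4+(b_1+b_2)\lambda^3+(c^2\xi^2+b_1b_2)\lambda^2+\xi^2(a_1+c^2b_1+a_2+c^2b_2)\lambda+\xi^2(c^2b_1b_2+a_1b_2+a_2b_1),$$ and let $\Delta_2,\Delta_3$ be its second and third Hurwitz determinants (defined in the context). Roots of $g$ are counted with multiplicity. Then: (i) When $g(0)>0$: all roots of $g$ have negative real parts if $\Delta_2>0$ and $\Delta_3>0$; otherwise two roots have negative real parts and two roots have non-negative real parts. (ii) (a) When $g(0)=0$ and $g'(0)>0$: one root is zero and three have negative real parts if $\Delta_2>0$; otherwise there is one zero root, one negative root, and two roots with non-negative real parts. (b) When $g(0)=0$ and $g'(0)=0$: there are two roots with negative real parts and zero is a two-fold root. (c) When $g(0)=0$ and $g'(0)<0$: there is a zero root, a positive root, and two roots with negative real parts. (iii) When $g(0)<0$: one root is negative and three roots have positive real parts if $\Delta_2<0$ and $\Delta_3<0$; otherwise one root is positive and three roots have non-positive real parts.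
   Context: The polynomial $g$ is the characteristic polynomial of the $4\times4$ matrix $\Phi(i\xi)=-(B+i\xi A)$, where, in the variables $(u,v,w_1,w_2)$, $A(u,v,w_1,w_2)=(v,c^2u,-a_1u,-a_2u)$ and $B(u,v,w_1,w_2)=(0,w_1+w_2,b_1w_1,b_2w_2)$; so the roots of $g$ are the eigenvalues of $\Phi(i\xi)$. The Hurwitz determinants are $$\Delta_2=\begin{vmatrix}b_1+b_2&g'(0)\\1&c^2\xi^2+b_1b_2\end{vmatrix},\qquad \Delta_3=\begin{vmatrix}b_1+b_2&g'(0)&0\\1&c^2\xi^2+b_1b_2&g(0)\\0&b_1+b_2&g'(0)\end{vmatrix}.$$ *)

theory Defs
  imports "HOL-Analysis.Analysis" "HOL-Computational_Algebra.Polynomial"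
begin

definition g_poly :: "real \<Rightarrow> real \<Rightarrow> real \<Rightarrow> real \<Rightarrow> real \<Rightarrow> real \<Rightarrow> real poly" where
  "g_poly c a1 a2 b1 b2 \<xi> =
     [: \<xi>^2 * (c^2 * b1 * b2 + a1 * b2 + a2 * b1),
        \<xi>^2 * (a1 + c^2 * b1 + a2 + c^2 * b2),
        c^2 * \<xi>^2 + b1 * b2,
        b1 + b2,
        1 :]"

definition Hurwitz2 :: "real \<Rightarrow> real \<Rightarrow> real \<Rightarrow> real \<Rightarrow> real \<Rightarrow> real \<Rightarrow> real" where
  "Hurwitz2 c a1 a2 b1 b2 \<xi> =
     (let g = g_poly c a1 a2 b1 b2 \<xi> in
      det (vector
        [vector [b1 + b2, poly (pderiv g) 0],
         vector [1,       c^2 * \<xi>^2 + b1 * b2]] :: real^2^2))"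

definition Hurwitz3 :: "real \<Rightarrow> real \<Rightarrow> real \<Rightarrow> real \<Rightarrow> real \<Rightarrow> real \<Rightarrow> real" where
  "Hurwitz3 c a1 a2 b1 b2 \<xi> =
     (let g = g_poly c a1 a2 b1 b2 \<xi> in
      det (vector
        [vector [b1 + b2, poly (pderiv g) 0,        0],
         vector [1,       c^2 * \<xi>^2 + b1 * b2, poly g 0],
         vector [0,       b1 + b2,                  poly (pderiv g) 0]] :: real^3^3))"

text \<open>The number of complex roots of a real polynomial, counted with multiplicity,
  that satisfy a given condition.\<close>

definition num_roots :: "real poly \<Rightarrow> (complex \<Rightarrow> bool) \<Rightarrow> nat" where
  "num_roots p P = size (filter_mset P (proots (map_poly complex_of_real p)))"

end

theory Submission
  imports Defs "HOL-Computational_Algebra.Fundamental_Theorem_Algebra"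
begin

text \<open>
  The polynomial \<open>g = \<lambda>\<^sup>4 + p \<lambda>\<^sup>3 + q \<lambda>\<^sup>2 + r \<lambda> + s\<close> has \<open>p > 0\<close> and \<open>q > 0\<close>, and the argument
  is about such quartics. A real quartic is a product of two real quadratics,
  \<open>(\<lambda>\<^sup>2 + \<alpha> \<lambda> + \<beta>) (\<lambda>\<^sup>2 + \<gamma> \<lambda> + \<delta>)\<close>, and the position of the roots of a single quadratic can be
  read off its coefficients. If \<open>\<beta> > 0\<close>, the real parts of both roots have the sign of \<open>-\<alpha>\<close>
  (\<open>sgn_Re_root_quadratic\<close>); if \<open>\<beta> < 0\<close>, there are one positive and one negative root
  (\<open>quadratic_split_real\<close>). Root counting is additive over products (\<open>num_roots_mult\<close>), so it
  only remains to express the Hurwitz determinants \<open>\<Delta>\<^sub>2 = p q - r\<close> and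
  \<open>\<Delta>\<^sub>3 = p q r - p\<^sup>2 s - r\<^sup>2\<close> in the coefficients of the factors. Throughout,
  \<open>r \<Delta>\<^sub>2 = \<Delta>\<^sub>3 + p\<^sup>2 s\<close> links the signs of the two determinants.

  For \<open>s = \<beta> \<delta> > 0\<close> the key identity is
  \<open>\<Delta>\<^sub>3 = \<alpha> \<gamma> ((\<beta> - \<delta>)\<^sup>2 + p r)\<close>. It shows that both determinants are positive exactly when
  \<open>\<alpha>, \<beta>, \<gamma>, \<delta>\<close> are (\<open>hurwitz_iff_positive_factors\<close>); since \<open>\<alpha> + \<gamma> = p > 0\<close>, every other sign
  pattern has precisely two roots in the open left half-plane.

  For \<open>s < 0\<close> one quadratic splits, so that
  \<open>g = (\<lambda> - t) (\<lambda> + u) (\<lambda>\<^sup>2 + m \<lambda> + n)\<close> with \<open>t, u, n > 0\<close>, and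
  \<open>\<Delta>\<^sub>3 = (u - t) m (t\<^sup>2 - m t + n) (u\<^sup>2 + m u + n)\<close>. Both determinants are negative exactly when
  \<open>m < 0\<close> (\<open>hurwitz_negative_iff\<close>), and the sign of \<open>m\<close> places the remaining two roots.

  For \<open>s = 0\<close> one factors out \<open>\<lambda>\<close> and is left with a cubic
  \<open>(\<lambda> + k) (\<lambda>\<^sup>2 + m \<lambda> + n)\<close>. Here \<open>\<Delta>\<^sub>2 = m (k\<^sup>2 + q)\<close> has the sign of \<open>m\<close>, and \<open>r = k n\<close>.
\<close>

section \<open>Counting roots\<close>

lemma map_poly_of_real_mult:
  "map_poly complex_of_real (p * q) = map_poly complex_of_real p * map_poly complex_of_real q"
  by (rule poly_eqI) (simp add: coeff_map_poly coeff_mult)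

lemma map_poly_of_real_eq_0_iff [simp]: "map_poly complex_of_real p = 0 \<longleftrightarrow> p = 0"
  by (auto simp: poly_eq_iff coeff_map_poly)

lemma num_roots_mult:
  assumes "p \<noteq> 0" "q \<noteq> 0"
  shows "num_roots (p * q) P = num_roots p P + num_roots q P"
  using assms by (simp add: num_roots_def map_poly_of_real_mult proots_mult)

lemma num_roots_cong:
  assumes "p \<noteq> 0" "\<And>z. poly (map_poly complex_of_real p) z = 0 \<Longrightarrow> P z \<longleftrightarrow> Q z"
  shows "num_roots p P = num_roots p Q"
  unfolding num_roots_def using assms by (intro arg_cong[of _ _ size] filter_mset_cong) auto

lemma num_roots_all:
  assumes "p \<noteq> 0" "\<And>z. poly (map_poly complex_of_real p) z = 0 \<Longrightarrow> P z"
  shows "num_roots p P = degree p"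
  using num_roots_cong[of p P "\<lambda>_. True"] assms
  by (simp add: num_roots_def size_proots_complex degree_map_poly)

lemma num_roots_none:
  assumes "p \<noteq> 0" "\<And>z. poly (map_poly complex_of_real p) z = 0 \<Longrightarrow> \<not> P z"
  shows "num_roots p P = 0"
  using num_roots_cong[of p P "\<lambda>_. False"] assms by (simp add: num_roots_def)

lemma num_roots_linear [simp]:
  "num_roots [:a, 1:] P = (if P (- complex_of_real a) then 1 else 0)"
proof -
  have "map_poly complex_of_real [:a, 1:] = [:complex_of_real a, 1:]"
    by (simp add: map_poly_pCons)
  then show ?thesis by (simp add: num_roots_def)
qed

section \<open>Real quadratics\<close>

lemma poly_quadratic_of_real:
  "poly (map_poly complex_of_real [:\<beta>, \<alpha>, 1:]) z = z^2 + of_real \<alpha> * z + of_real \<beta>"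
  by (simp add: map_poly_pCons algebra_simps power2_eq_square)

text \<open>
  A non-real root is paired with its conjugate, and the sum \<open>-\<alpha>\<close> of the pair is twice its real
  part. Real roots have the same sign since their product \<open>\<beta>\<close> is positive.
\<close>

lemma sgn_Re_root_quadratic:
  assumes "\<beta> > 0" and root: "poly (map_poly complex_of_real [:\<beta>, \<alpha>, 1:]) z = 0"
  shows "sgn (Re z) = - sgn \<alpha>"
proof -
  have eq: "z^2 + of_real \<alpha> * z + of_real \<beta> = 0"
    using root by (simp only: poly_quadratic_of_real)
  from arg_cong[OF eq, of Re] have re: "(Re z)^2 - (Im z)^2 + \<alpha> * Re z + \<beta> = 0"
    by (simp add: power2_eq_square)
  from arg_cong[OF eq, of Im] have im: "Im z * (2 * Re z + \<alpha>) = 0"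
    by (simp add: power2_eq_square algebra_simps)
  show ?thesis
  proof (cases "Im z = 0")
    case True
    with re have "Re z * (- \<alpha>) = (Re z)^2 + \<beta>" by (simp add: algebra_simps)
    also have "\<dots> > 0" using \<open>\<beta> > 0\<close> by (simp add: add_nonneg_pos)
    finally show ?thesis by (auto simp: zero_less_mult_iff mult_less_0_iff sgn_if)
  next
    case False
    with im have "\<alpha> = -2 * Re z" by simp
    then show ?thesis by (simp add: sgn_if)
  qed
qed

lemma num_roots_quadratic:
  assumes "\<beta> > 0"
  shows "(\<And>z. sgn (Re z) = - sgn \<alpha> \<Longrightarrow> P z) \<Longrightarrow> num_roots [:\<beta>, \<alpha>, 1:] P = 2"
    and "(\<And>z. sgn (Re z) = - sgn \<alpha> \<Longrightarrow> \<not> P z) \<Longrightarrow> num_roots [:\<beta>, \<alpha>, 1:] P = 0"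
proof -
  show "num_roots [:\<beta>, \<alpha>, 1:] P = 2" if "\<And>z. sgn (Re z) = - sgn \<alpha> \<Longrightarrow> P z"
    using num_roots_all[of "[:\<beta>, \<alpha>, 1:]" P] sgn_Re_root_quadratic[OF assms] that by simp
  show "num_roots [:\<beta>, \<alpha>, 1:] P = 0" if "\<And>z. sgn (Re z) = - sgn \<alpha> \<Longrightarrow> \<not> P z"
    by (rule num_roots_none) (use sgn_Re_root_quadratic[OF assms] that in auto)
qed

lemma quadratic_split_real:
  assumes "\<beta> < (0::real)"
  obtains t u where "t > 0" "u > 0" "\<alpha> = u - t" "\<beta> = - (t * u)"
    "[:\<beta>, \<alpha>, 1:] = [:-t, 1:] * [:u, 1:]"
proof -
  define d where "d = sqrt (\<alpha>^2 - 4 * \<beta>)"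
  have d2: "d^2 = \<alpha>^2 - 4 * \<beta>"
    unfolding d_def using assms by (intro real_sqrt_pow2) (smt (verit) zero_le_power2)
  have "d > \<bar>\<alpha>\<bar>"
    unfolding d_def using assms real_sqrt_less_mono[of "\<alpha>^2" "\<alpha>^2 - 4 * \<beta>"] by simp
  then have pos: "(d - \<alpha>) / 2 > 0" "(d + \<alpha>) / 2 > 0" by auto
  have prod: "\<beta> = - ((d - \<alpha>) / 2 * ((d + \<alpha>) / 2))"
    using d2 by (simp add: field_simps power2_eq_square)
  show thesis
    by (rule that[OF pos _ prod]) (use prod in \<open>auto simp: field_simps\<close>)
qed

section \<open>Factorization of real polynomials\<close>

text \<open>
  The remainder of \<open>p\<close> modulo the minimal polynomial of a non-real root is linear and vanishes
  at that root, hence is zero.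
\<close>

lemma nonreal_root_quadratic_dvd:
  fixes p :: "real poly"
  assumes root: "poly (map_poly complex_of_real p) z = 0" and "Im z \<noteq> 0"
  shows "[:(Re z)^2 + (Im z)^2, - 2 * Re z, 1:] dvd p"
proof -
  define d where "d = [:(Re z)^2 + (Im z)^2, - 2 * Re z, 1:]"
  define R where "R = p mod d"
  have p: "p = p div d * d + R" by (simp add: R_def)
  have d0: "d \<noteq> 0" and degd: "degree d = 2" by (simp_all add: d_def)
  have "degree R < 2" using degree_mod_less[OF d0, of p] degd by (auto simp: R_def)
  then have R: "R = [:coeff R 0, coeff R 1:]"
    by (intro poly_eqI) (auto simp: coeff_pCons coeff_eq_0 split: nat.split)
  have dz: "poly (map_poly complex_of_real d) z = 0"
    unfolding d_def poly_quadratic_of_real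
    by (simp add: complex_eq_iff power2_eq_square algebra_simps)
  have add: "map_poly complex_of_real (a + b) =
      map_poly complex_of_real a + map_poly complex_of_real b" for a b
    by (rule poly_eqI) (simp add: coeff_map_poly)
  have "poly (map_poly complex_of_real R) z = 0"
    using root dz by (subst (asm) p) (simp add: add map_poly_of_real_mult)
  then have "complex_of_real (coeff R 0) + z * of_real (coeff R 1) = 0"
    by (subst (asm) R) (simp add: map_poly_pCons)
  then have "coeff R 1 = 0 \<and> coeff R 0 = 0"
    using \<open>Im z \<noteq> 0\<close> by (auto simp: complex_eq_iff)
  with R have "R = 0" by simp
  then show ?thesis by (simp add: R_def mod_eq_0_iff_dvd d_def)
qed

lemma real_poly_irreducible_factor:
  fixes p :: "real poly"
  assumes "degree p > 0"
  shows "(\<exists>t. [:-t, 1:] dvd p) \<or> (\<exists>\<alpha> \<beta>. [:\<beta>, \<alpha>, 1:] dvd p)"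
proof -
  have "\<not> constant (poly (map_poly complex_of_real p))"
    using assms by (simp add: constant_degree degree_map_poly)
  then obtain z where z: "poly (map_poly complex_of_real p) z = 0"
    using fundamental_theorem_of_algebra by blast
  show ?thesis
  proof (cases "Im z = 0")
    case True
    then have "z = of_real (Re z)" by (simp add: complex_eq_iff)
    moreover have "poly (map_poly complex_of_real p) (of_real x) = of_real (poly p x)" for x
      by (induction p) (simp_all add: map_poly_pCons)
    ultimately have "poly p (Re z) = 0"
      using z by (metis of_real_eq_0_iff)
    then show ?thesis by (auto simp: poly_eq_0_iff_dvd)
  next
    case False
    then show ?thesis using nonreal_root_quadratic_dvd[OF z] by blast
  qed
qed

text \<open>
  If the first irreducible factor is linear, a second one is taken from the cofactor; either that
  one is quadratic or the two linear factors are multiplied.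
\<close>

lemma real_poly_quadratic_factor:
  fixes p :: "real poly"
  assumes "degree p \<ge> 2"
  shows "\<exists>\<alpha> \<beta>. [:\<beta>, \<alpha>, 1:] dvd p"
proof (rule ccontr)
  assume no: "\<not> ?thesis"
  with real_poly_irreducible_factor[of p] assms obtain t where "[:-t, 1:] dvd p" by auto
  then obtain h where h: "p = [:-t, 1:] * h" by (auto elim: dvdE)
  with assms have "h \<noteq> 0" by auto
  then have "degree p = 1 + degree h" unfolding h by (subst degree_mult_eq) auto
  with assms have "degree h > 0" by simp
  with real_poly_irreducible_factor[of h] no h obtain u where "[:-u, 1:] dvd h"
    by (meson dvd_mult)
  then have "[:-t, 1:] * [:-u, 1:] dvd p" by (simp only: h mult_dvd_mono dvd_refl)
  also have "[:-t, 1:] * [:-u, 1:] = [:t * u, - t - u, 1:]" by simp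
  finally show False using no by blast
qed

lemma monic_quartic_factor:
  obtains \<alpha> \<beta> \<gamma> \<delta> :: real where
    "[:s, r, q, p, 1:] = [:\<beta>, \<alpha>, 1:] * [:\<delta>, \<gamma>, 1:]"
    "p = \<alpha> + \<gamma>" "q = \<beta> + \<delta> + \<alpha> * \<gamma>" "r = \<alpha> * \<delta> + \<beta> * \<gamma>" "s = \<beta> * \<delta>"
proof -
  obtain \<alpha> \<beta> where "[:\<beta>, \<alpha>, 1:] dvd [:s, r, q, p, 1:]"
    using real_poly_quadratic_factor[of "[:s, r, q, p, 1:]"] by auto
  then obtain h where h: "[:s, r, q, p, 1:] = [:\<beta>, \<alpha>, 1:] * h" by (auto elim: dvdE)
  then have "h \<noteq> 0" by auto
  from arg_cong[OF h, of degree] this have deg: "degree h = 2"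
    by (subst (asm) degree_mult_eq) auto
  from arg_cong[OF h, of lead_coeff] have "coeff h 2 = 1"
    by (simp only: lead_coeff_mult) (simp add: deg)
  then have "h = [:coeff h 0, coeff h 1, 1:]"
    using deg by (intro poly_eqI)
      (auto simp: coeff_pCons coeff_eq_0 numeral_2_eq_2 split: nat.split)
  with h have fac: "[:s, r, q, p, 1:] = [:\<beta>, \<alpha>, 1:] * [:coeff h 0, coeff h 1, 1:]" by simp
  show thesis by (rule that[OF fac]) (use fac in \<open>auto simp: algebra_simps\<close>)
qed

section \<open>The monic quartic with positive cubic and quadratic coefficients\<close>

lemma num_roots_two_quadratics:
  "num_roots ([:\<beta>, \<alpha>, 1:] * [:\<delta>, \<gamma>, 1:]) P =
     num_roots [:\<beta>, \<alpha>, 1:] P + num_roots [:\<delta>, \<gamma>, 1:] P"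
  by (rule num_roots_mult) auto

lemma num_roots_linear_mult:
  "p \<noteq> 0 \<Longrightarrow> num_roots ([:a, 1:] * p) P = (if P (- complex_of_real a) then 1 else 0) + num_roots p P"
  by (subst num_roots_mult) auto

lemma num_roots_two_linear_factors:
  "num_roots ([:a, 1:] * ([:b, 1:] * [:n, m, 1:])) P =
     (if P (- complex_of_real a) then 1 else 0) +
     ((if P (- complex_of_real b) then 1 else 0) + num_roots [:n, m, 1:] P)"
proof -
  have "[:b, 1:] * [:n, m, 1:] \<noteq> 0" by (simp only: mult_eq_0_iff) simp
  from num_roots_linear_mult[OF this] show ?thesis
    by (simp only: num_roots_linear_mult[of "[:n, m, 1:]" b] pCons_eq_0_iff one_neq_zero simp_thms)
qed

lemma hurwitz3_two_quadratics:
  fixes \<alpha> \<beta> \<gamma> \<delta> :: real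
  assumes "p = \<alpha> + \<gamma>" "q = \<beta> + \<delta> + \<alpha> * \<gamma>" "r = \<alpha> * \<delta> + \<beta> * \<gamma>" "s = \<beta> * \<delta>"
  shows "p * q * r - p^2 * s - r^2 = \<alpha> * \<gamma> * ((\<beta> - \<delta>)^2 + p * r)"
  unfolding assms by algebra

text \<open>
  If both determinants are positive, then \<open>r > 0\<close>, since \<open>r \<Delta>\<^sub>2 = \<Delta>\<^sub>3 + p\<^sup>2 s\<close>. The identity
  for \<open>\<Delta>\<^sub>3\<close> now makes \<open>\<alpha> \<gamma>\<close> positive, so that \<open>p > 0\<close> makes both \<open>\<alpha>\<close> and \<open>\<gamma>\<close> positive, and
  then \<open>r = \<alpha> \<delta> + \<beta> \<gamma> > 0\<close> forbids \<open>\<beta>, \<delta> < 0\<close>. Conversely, positive factors give \<open>r > 0\<close>, hence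
  \<open>\<Delta>\<^sub>3 > 0\<close> by the identity and \<open>\<Delta>\<^sub>2 > 0\<close> from \<open>r \<Delta>\<^sub>2 > 0\<close>.
\<close>

lemma hurwitz_iff_positive_factors:
  fixes \<alpha> \<beta> \<gamma> \<delta> :: real
  assumes "p > 0" "s > 0"
    and c: "p = \<alpha> + \<gamma>" "q = \<beta> + \<delta> + \<alpha> * \<gamma>" "r = \<alpha> * \<delta> + \<beta> * \<gamma>" "s = \<beta> * \<delta>"
  shows "p * q - r > 0 \<and> p * q * r - p^2 * s - r^2 > 0 \<longleftrightarrow>
           \<alpha> > 0 \<and> \<beta> > 0 \<and> \<gamma> > 0 \<and> \<delta> > 0" (is "?D2 > 0 \<and> ?D3 > 0 \<longleftrightarrow> _")
proof -
  have D3: "?D3 = \<alpha> * \<gamma> * ((\<beta> - \<delta>)^2 + p * r)" by (rule hurwitz3_two_quadratics[OF c])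
  have rD2: "r * ?D2 = ?D3 + p^2 * s" by algebra
  have ps: "p^2 * s > 0" using assms(1,2) by simp
  show ?thesis
  proof
    assume D: "?D2 > 0 \<and> ?D3 > 0"
    with rD2 ps have "r * ?D2 > 0" by linarith
    with D have r: "r > 0" by (metis zero_less_mult_pos2)
    then have "(\<beta> - \<delta>)^2 + p * r > 0" using \<open>p > 0\<close> by (simp add: add_nonneg_pos)
    with D D3 have "\<alpha> * \<gamma> > 0" by (metis zero_less_mult_pos2)
    with c(1) \<open>p > 0\<close> have ag: "\<alpha> > 0" "\<gamma> > 0" by (auto simp: zero_less_mult_iff)
    moreover have "\<beta> > 0 \<and> \<delta> > 0"
    proof (rule ccontr)
      assume "\<not> ?thesis"
      with c(4) \<open>s > 0\<close> have "\<beta> < 0" "\<delta> < 0" by (auto simp: zero_less_mult_iff)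
      with ag have "\<alpha> * \<delta> < 0" "\<beta> * \<gamma> < 0" by (auto simp: mult_less_0_iff)
      with r c(3) show False by linarith
    qed
    ultimately show "\<alpha> > 0 \<and> \<beta> > 0 \<and> \<gamma> > 0 \<and> \<delta> > 0" by blast
  next
    assume pos: "\<alpha> > 0 \<and> \<beta> > 0 \<and> \<gamma> > 0 \<and> \<delta> > 0"
    then have r: "r > 0" unfolding c by (simp add: add_pos_pos)
    then have "(\<beta> - \<delta>)^2 + p * r > 0" using \<open>p > 0\<close> by (simp add: add_nonneg_pos)
    with pos D3 have "?D3 > 0" by simp
    moreover from this rD2 ps have "r * ?D2 > 0" by linarith
    ultimately show "?D2 > 0 \<and> ?D3 > 0" using r by (metis zero_less_mult_pos)
  qed
qed

text \<open>
  If the determinant conditions fail while \<open>\<beta>, \<delta> > 0\<close>, exactly one of \<open>\<alpha>, \<gamma>\<close> is positive, and that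
  factor contributes both left roots. If \<open>\<beta>, \<delta> < 0\<close>, each factor contributes one.
\<close>

lemma quartic_positive_constant:
  assumes "p > 0" "s > 0"
  shows "if p * q - r > 0 \<and> p * q * r - p^2 * s - r^2 > 0
         then \<forall>z. poly (map_poly complex_of_real [:s, r, q, p, 1:]) z = 0 \<longrightarrow> Re z < 0
         else num_roots [:s, r, q, p, 1:] (\<lambda>z. Re z < 0) = 2 \<and>
              num_roots [:s, r, q, p, 1:] (\<lambda>z. Re z \<ge> 0) = 2"
proof -
  obtain \<alpha> \<beta> \<gamma> \<delta> :: real where fac: "[:s, r, q, p, 1:] = [:\<beta>, \<alpha>, 1:] * [:\<delta>, \<gamma>, 1:]"
    and c: "p = \<alpha> + \<gamma>" "q = \<beta> + \<delta> + \<alpha> * \<gamma>" "r = \<alpha> * \<delta> + \<beta> * \<gamma>" "s = \<beta> * \<delta>"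
    by (rule monic_quartic_factor)
  note iff = hurwitz_iff_positive_factors[OF assms c]
  show ?thesis
  proof (cases "p * q - r > 0 \<and> p * q * r - p^2 * s - r^2 > 0")
    case True
    with iff have pos: "\<alpha> > 0" "\<beta> > 0" "\<gamma> > 0" "\<delta> > 0" by auto
    have "Re z < 0" if "poly (map_poly complex_of_real [:s, r, q, p, 1:]) z = 0" for z
    proof -
      from that have "poly (map_poly complex_of_real [:\<beta>, \<alpha>, 1:]) z = 0 \<or>
          poly (map_poly complex_of_real [:\<delta>, \<gamma>, 1:]) z = 0"
        unfolding fac by (simp only: map_poly_of_real_mult poly_mult mult_eq_0_iff)
      with sgn_Re_root_quadratic pos have "sgn (Re z) = - 1" by (metis sgn_pos)
      then show ?thesis by (simp add: sgn_if split: if_splits)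
    qed
    with True show ?thesis by simp
  next
    case False
    consider "\<beta> > 0" "\<delta> > 0" | "\<beta> < 0" "\<delta> < 0"
      using c(4) \<open>s > 0\<close> by (auto simp: zero_less_mult_iff)
    then have "num_roots [:s, r, q, p, 1:] (\<lambda>z. Re z < 0) = 2 \<and>
        num_roots [:s, r, q, p, 1:] (\<lambda>z. Re z \<ge> 0) = 2"
    proof cases
      case 1
      have left: "num_roots [:b, a, 1:] (\<lambda>z. Re z < 0) = 2"
        "num_roots [:b, a, 1:] (\<lambda>z. Re z \<ge> 0) = 0" if "b > 0" "a > 0" for a b
        using that by (auto intro!: num_roots_quadratic simp: sgn_if split: if_splits)
      have right: "num_roots [:b, a, 1:] (\<lambda>z. Re z < 0) = 0"
        "num_roots [:b, a, 1:] (\<lambda>z. Re z \<ge> 0) = 2" if "b > 0" "a \<le> 0" for a b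
        using that by (auto intro!: num_roots_quadratic simp: sgn_if split: if_splits)
      from 1 False iff c(1) \<open>p > 0\<close> consider "\<alpha> > 0" "\<gamma> \<le> 0" | "\<alpha> \<le> 0" "\<gamma> > 0" by linarith
      then show ?thesis
        unfolding fac num_roots_two_quadratics by cases (simp_all add: left right 1)
    next
      case 2
      have split: "num_roots [:b, a, 1:] (\<lambda>z. Re z < 0) = 1"
        "num_roots [:b, a, 1:] (\<lambda>z. Re z \<ge> 0) = 1" if b: "b < 0" for a b
      proof -
        obtain t u where *: "t > 0" "u > 0" "[:b, a, 1:] = [:-t, 1:] * [:u, 1:]"
          using quadratic_split_real[OF b] by metis
        show "num_roots [:b, a, 1:] (\<lambda>z. Re z < 0) = 1" "num_roots [:b, a, 1:] (\<lambda>z. Re z \<ge> 0) = 1"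
          unfolding *(3) by (subst num_roots_linear_mult; use *(1,2) in simp)+
      qed
      show ?thesis unfolding fac num_roots_two_quadratics by (simp add: split 2)
    qed
    with False show ?thesis by (simp only: if_False)
  qed
qed

text \<open>
  If \<open>m \<ge> 0\<close> and \<open>\<Delta>\<^sub>2 < 0\<close>, then \<open>r > p q > 0\<close>, that is
  \<open>m t u < n (u - t)\<close>. This gives \<open>t < u\<close> and \<open>m t < n\<close>, which makes every factor of \<open>\<Delta>\<^sub>3\<close>
  nonnegative. Conversely, \<open>m < 0\<close> and \<open>p > 0\<close> give \<open>u > t - m\<close>, so that every factor of
  \<open>\<Delta>\<^sub>3\<close> except \<open>m\<close> is positive; moreover \<open>r > 0\<close>, and \<open>r \<Delta>\<^sub>2 = \<Delta>\<^sub>3 + p\<^sup>2 s < 0\<close>.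
\<close>

lemma hurwitz_negative_iff:
  fixes t u m n :: real
  assumes "p > 0" "q > 0" and pos: "t > 0" "u > 0" "n > 0"
    and c: "p = u - t + m" "q = n - t * u + m * (u - t)" "r = n * (u - t) - m * t * u"
      "s = - (t * u * n)"
  shows "p * q - r < 0 \<and> p * q * r - p^2 * s - r^2 < 0 \<longleftrightarrow> m < 0"
    (is "?D2 < 0 \<and> ?D3 < 0 \<longleftrightarrow> _")
proof -
  have D3: "?D3 = (u - t) * m * (t^2 - m * t + n) * (u^2 + m * u + n)"
    unfolding c by algebra
  have rD2: "r * ?D2 = ?D3 + p^2 * s" by algebra
  have s: "s < 0" using pos c(4) by simp
  show ?thesis
  proof
    assume D: "?D2 < 0 \<and> ?D3 < 0"
    show "m < 0"
    proof (rule ccontr)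
      assume "\<not> m < 0"
      then have m: "m \<ge> 0" by simp
      have "p * q > 0" using assms(1,2) by simp
      with D c(3) have r: "m * t * u < n * (u - t)" by linarith
      have "m * t * u \<ge> 0" using m pos by simp
      with r have "n * (u - t) > 0" by linarith
      with pos have ut: "u > t" by (simp add: zero_less_mult_iff)
      have "n * (u - t) < n * u" using pos by simp
      with r have "m * t * u < n * u" by linarith
      with pos have "m * t < n" by simp
      then have "t^2 - m * t + n \<ge> 0" by (smt (verit) zero_le_power2)
      moreover have "u^2 + m * u + n \<ge> 0" using m pos by simp
      ultimately have "?D3 \<ge> 0" unfolding D3 using ut m by simp
      with D show False by linarith
    qed
  next
    assume m: "m < 0"
    with c(1) \<open>p > 0\<close> have ut: "u > t" "u > - m" using pos by linarith+
    have "m * t < 0" "m * t * u < 0" using m pos by (simp_all add: mult_neg_pos)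
    have "t^2 - m * t + n > 0" using \<open>m * t < 0\<close> pos by (smt (verit) zero_le_power2)
    moreover have "u * (u + m) > 0" using ut pos by simp
    then have "u^2 + m * u + n > 0" using pos by (simp add: algebra_simps power2_eq_square)
    moreover have "(u - t) * m < 0" using ut m by (simp add: mult_pos_neg)
    ultimately have "?D3 < 0" unfolding D3 by (simp add: mult_neg_pos)
    moreover have "p^2 * s < 0" using s \<open>p > 0\<close> by (simp add: mult_pos_neg)
    ultimately have "r * ?D2 < 0" using rD2 by linarith
    moreover have "n * (u - t) > 0" using ut pos by simp
    then have "r > 0" using c(3) \<open>m * t * u < 0\<close> by linarith
    ultimately have "?D2 < 0" by (simp add: mult_less_0_iff)
    with \<open>?D3 < 0\<close> show "?D2 < 0 \<and> ?D3 < 0" by blast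
  qed
qed

lemma quartic_negative_constant:
  assumes "p > 0" "q > 0" "s < 0"
  shows "if p * q - r < 0 \<and> p * q * r - p^2 * s - r^2 < 0
         then num_roots [:s, r, q, p, 1:] (\<lambda>z. z \<in> \<real> \<and> Re z < 0) = 1 \<and>
              num_roots [:s, r, q, p, 1:] (\<lambda>z. Re z > 0) = 3
         else num_roots [:s, r, q, p, 1:] (\<lambda>z. z \<in> \<real> \<and> Re z > 0) = 1 \<and>
              num_roots [:s, r, q, p, 1:] (\<lambda>z. Re z \<le> 0) = 3"
proof -
  obtain t u m n :: real where pos: "t > 0" "u > 0" "n > 0"
    and fac: "[:s, r, q, p, 1:] = [:-t, 1:] * ([:u, 1:] * [:n, m, 1:])"
  proof -
    obtain \<alpha> \<beta> \<gamma> \<delta> :: real where fac: "[:s, r, q, p, 1:] = [:\<beta>, \<alpha>, 1:] * [:\<delta>, \<gamma>, 1:]"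
      and "s = \<beta> * \<delta>" by (rule monic_quartic_factor)
    then consider "\<beta> < 0" "\<delta> > 0" | "\<delta> < 0" "\<beta> > 0"
      using \<open>s < 0\<close> by (auto simp: mult_less_0_iff)
    then show thesis
    proof cases
      case 1
      obtain t u where "t > 0" "u > 0" "[:\<beta>, \<alpha>, 1:] = [:-t, 1:] * [:u, 1:]"
        using quadratic_split_real[OF 1(1)] by metis
      with fac 1 show thesis by (intro that[of t u \<delta> \<gamma>]) (simp_all only: mult.assoc)
    next
      case 2
      obtain t u where "t > 0" "u > 0" "[:\<delta>, \<gamma>, 1:] = [:-t, 1:] * [:u, 1:]"
        using quadratic_split_real[OF 2(1)] by metis
      with fac 2 show thesis by (intro that[of t u \<beta> \<alpha>]) (simp_all only: mult_ac)
    qed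
  qed
  have c: "p = u - t + m" "q = n - t * u + m * (u - t)" "r = n * (u - t) - m * t * u"
      "s = - (t * u * n)"
    using fac by (simp_all add: algebra_simps)
  have count: "num_roots [:s, r, q, p, 1:] P = (if P (of_real t) then 1 else 0) +
      ((if P (- of_real u) then 1 else 0) + num_roots [:n, m, 1:] P)" for P
    unfolding fac by (subst num_roots_two_linear_factors) simp_all
  show ?thesis
  proof (cases "m < 0")
    case True
    have "num_roots [:n, m, 1:] (\<lambda>z. z \<in> \<real> \<and> Re z < 0) = 0"
      "num_roots [:n, m, 1:] (\<lambda>z. Re z > 0) = 2"
      using True pos by (auto intro!: num_roots_quadratic simp: sgn_if split: if_splits)
    then show ?thesis
      using True pos hurwitz_negative_iff[OF assms(1,2) pos c] by (simp add: count)
  next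
    case False
    have "num_roots [:n, m, 1:] (\<lambda>z. z \<in> \<real> \<and> Re z > 0) = 0"
      "num_roots [:n, m, 1:] (\<lambda>z. Re z \<le> 0) = 2"
      using False pos by (auto intro!: num_roots_quadratic simp: sgn_if split: if_splits)
    then have "num_roots [:s, r, q, p, 1:] (\<lambda>z. z \<in> \<real> \<and> Re z > 0) = 1"
      "num_roots [:s, r, q, p, 1:] (\<lambda>z. Re z \<le> 0) = 3"
      using pos by (simp_all add: count)
    then show ?thesis
      using False hurwitz_negative_iff[OF assms(1,2) pos c] by auto
  qed
qed

lemma quartic_zero_constant_factor:
  obtains k m n :: real where "[:0, r, q, p, 1:] = [:0, 1:] * ([:k, 1:] * [:n, m, 1:])"
    "p = k + m" "q = n + k * m" "r = k * n"
proof -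
  obtain \<alpha> \<beta> \<gamma> \<delta> :: real where fac: "[:0, r, q, p, 1:] = [:\<beta>, \<alpha>, 1:] * [:\<delta>, \<gamma>, 1:]"
    and "0 = \<beta> * \<delta>" by (rule monic_quartic_factor)
  then consider "\<beta> = 0" | "\<delta> = 0" by auto
  then have "\<exists>k m n. [:0, r, q, p, 1:] = [:0, 1:] * ([:k, 1:] * [:n, m, 1:])"
  proof cases
    case 1
    have "[:0, r, q, p, 1:] = [:0, 1:] * ([:\<alpha>, 1:] * [:\<delta>, \<gamma>, 1:])"
      unfolding fac 1 by simp
    then show ?thesis by blast
  next
    case 2
    have "[:0, r, q, p, 1:] = [:0, 1:] * ([:\<gamma>, 1:] * [:\<beta>, \<alpha>, 1:])"
      unfolding fac 2 by (simp add: algebra_simps)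
    then show ?thesis by blast
  qed
  then obtain k m n where f: "[:0, r, q, p, 1:] = [:0, 1:] * ([:k, 1:] * [:n, m, 1:])" by blast
  show thesis by (rule that[OF f]) (use f in \<open>auto simp: algebra_simps\<close>)
qed

lemma quartic_zero_constant_positive_linear:
  assumes "p > 0" "q > 0" "r > 0"
  shows "if p * q - r > 0
         then num_roots [:0, r, q, p, 1:] (\<lambda>z. z = 0) = 1 \<and>
              num_roots [:0, r, q, p, 1:] (\<lambda>z. Re z < 0) = 3
         else num_roots [:0, r, q, p, 1:] (\<lambda>z. z = 0) = 1 \<and>
              num_roots [:0, r, q, p, 1:] (\<lambda>z. z \<in> \<real> \<and> Re z < 0) = 1 \<and>
              num_roots [:0, r, q, p, 1:] (\<lambda>z. z \<noteq> 0 \<and> Re z \<ge> 0) = 2"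
proof -
  obtain k m n :: real where fac: "[:0, r, q, p, 1:] = [:0, 1:] * ([:k, 1:] * [:n, m, 1:])"
    and c: "p = k + m" "q = n + k * m" "r = k * n" by (rule quartic_zero_constant_factor)
  \<comment> \<open>If \<open>k, n < 0\<close>, then \<open>q > 0\<close> would force \<open>m < 0\<close>, contradicting \<open>p > 0\<close>.\<close>
  have kn: "k > 0" "n > 0"
  proof -
    have "\<not> (k < 0 \<and> n < 0)"
    proof
      assume neg: "k < 0 \<and> n < 0"
      with c(2) \<open>q > 0\<close> have "k * m > 0" by linarith
      with neg have "m < 0" by (simp add: zero_less_mult_iff)
      with neg c(1) \<open>p > 0\<close> show False by linarith
    qed
    with c(3) \<open>r > 0\<close> show "k > 0" "n > 0" by (auto simp: zero_less_mult_iff)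
  qed
  have "p * q - r = m * (k^2 + q)" unfolding c by algebra
  moreover have "k^2 + q > 0" using \<open>q > 0\<close> by (simp add: add_nonneg_pos)
  ultimately have D2: "r < p * q \<longleftrightarrow> m > 0"
    by (metis diff_gt_0_iff_gt zero_less_mult_pos2 mult_pos_pos)
  have count: "num_roots [:0, r, q, p, 1:] P = (if P 0 then 1 else 0) +
      ((if P (- of_real k) then 1 else 0) + num_roots [:n, m, 1:] P)" for P
    unfolding fac by (subst num_roots_two_linear_factors) simp_all
  have "poly (map_poly complex_of_real [:n, m, 1:]) 0 \<noteq> 0"
    using kn by (simp add: map_poly_pCons)
  then have zero: "num_roots [:n, m, 1:] (\<lambda>z. z = 0) = 0"
    "num_roots [:n, m, 1:] (\<lambda>z. z \<noteq> 0 \<and> Q z) = num_roots [:n, m, 1:] Q" for Q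
    using kn by (auto intro!: num_roots_none num_roots_cong)
  show ?thesis
  proof (cases "m > 0")
    case True
    then have "num_roots [:n, m, 1:] (\<lambda>z. Re z < 0) = 2"
      using kn by (auto intro!: num_roots_quadratic simp: sgn_if split: if_splits)
    then show ?thesis using True kn by (simp add: D2 count zero)
  next
    case False
    then have "num_roots [:n, m, 1:] (\<lambda>z. Re z \<ge> 0) = 2"
      "num_roots [:n, m, 1:] (\<lambda>z. z \<in> \<real> \<and> Re z < 0) = 0"
      using kn by (auto intro!: num_roots_quadratic simp: sgn_if split: if_splits)
    then show ?thesis using False kn by (simp add: D2 count zero)
  qed
qed

lemma quartic_double_zero:
  assumes "p > 0" "q > 0"
  shows "num_roots [:0, 0, q, p, 1:] (\<lambda>z. Re z < 0) = 2 \<and>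
         num_roots [:0, 0, q, p, 1:] (\<lambda>z. z = 0) = 2"
proof -
  have "[:0, 0, q, p, 1:] = [:0, 1:] * ([:0, 1:] * [:q, p, 1:])" by simp
  then have count: "num_roots [:0, 0, q, p, 1:] P =
      (if P 0 then 1 else 0) + ((if P 0 then 1 else 0) + num_roots [:q, p, 1:] P)" for P
    by (simp only: num_roots_two_linear_factors) simp
  have "num_roots [:q, p, 1:] (\<lambda>z. Re z < 0) = 2" "num_roots [:q, p, 1:] (\<lambda>z. z = 0) = 0"
    using assms by (auto intro!: num_roots_quadratic simp: sgn_if split: if_splits)
  then show ?thesis by (simp add: count)
qed

lemma quartic_zero_constant_negative_linear:
  assumes "p > 0" "q > 0" "r < 0"
  shows "num_roots [:0, r, q, p, 1:] (\<lambda>z. z = 0) = 1 \<and>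
         num_roots [:0, r, q, p, 1:] (\<lambda>z. z \<in> \<real> \<and> Re z > 0) = 1 \<and>
         num_roots [:0, r, q, p, 1:] (\<lambda>z. Re z < 0) = 2"
proof -
  obtain k m n :: real where fac: "[:0, r, q, p, 1:] = [:0, 1:] * ([:k, 1:] * [:n, m, 1:])"
    and c: "p = k + m" "q = n + k * m" "r = k * n" by (rule quartic_zero_constant_factor)
  have count: "num_roots [:0, r, q, p, 1:] P = (if P 0 then 1 else 0) +
      ((if P (- of_real k) then 1 else 0) + num_roots [:n, m, 1:] P)" for P
    unfolding fac by (subst num_roots_two_linear_factors) simp_all
  consider "k < 0" "n > 0" | "k > 0" "n < 0"
    using c(3) \<open>r < 0\<close> by (auto simp: mult_less_0_iff)
  then show ?thesis
  proof cases
    \<comment> \<open>The positive root is \<open>- k\<close>; the quadratic supplies the two left roots.\<close>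
    case 1
    with c(1) \<open>p > 0\<close> have "m > 0" by linarith
    then have "num_roots [:n, m, 1:] (\<lambda>z. Re z < 0) = 2"
      "num_roots [:n, m, 1:] (\<lambda>z. z = 0) = 0"
      "num_roots [:n, m, 1:] (\<lambda>z. z \<in> \<real> \<and> Re z > 0) = 0"
      using 1 by (auto intro!: num_roots_quadratic simp: sgn_if split: if_splits)
    then show ?thesis using 1 by (simp add: count)
  next
    \<comment> \<open>The left roots are \<open>- k\<close> and \<open>- u\<close>; the positive root is \<open>t\<close>.\<close>
    case 2
    obtain t u where *: "t > 0" "u > 0" "[:n, m, 1:] = [:-t, 1:] * [:u, 1:]"
      using quadratic_split_real[OF 2(2)] by metis
    have "num_roots [:n, m, 1:] P =
        (if P (of_real t) then 1 else 0) + (if P (- of_real u) then 1 else 0)" for P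
      unfolding *(3) by (subst num_roots_linear_mult) auto
    then show ?thesis using 2 * by (simp add: count)
  qed
qed

section \<open>The characteristic polynomial\<close>

theorem proposition4p3:
  fixes c a1 a2 b1 b2 \<xi> :: real
    and g :: "real poly" and \<Delta>2 \<Delta>3 :: real
  assumes "\<xi> \<noteq> 0"
    and "c^2 > 0"
    and "b1 > 0" and "b2 > 0" and "b1 \<noteq> b2"
    and "a1 * a2 < 0"
    and g: "g = g_poly c a1 a2 b1 b2 \<xi>"
    and \<Delta>2: "\<Delta>2 = Hurwitz2 c a1 a2 b1 b2 \<xi>"
    and \<Delta>3: "\<Delta>3 = Hurwitz3 c a1 a2 b1 b2 \<xi>"
  shows
    "(poly g 0 > 0 \<longrightarrow>
        (if \<Delta>2 > 0 \<and> \<Delta>3 > 0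
         then (\<forall>z. poly (map_poly complex_of_real g) z = 0 \<longrightarrow> Re z < 0)
         else num_roots g (\<lambda>z. Re z < 0) = 2 \<and> num_roots g (\<lambda>z. Re z \<ge> 0) = 2))
   \<and> (poly g 0 = 0 \<and> poly (pderiv g) 0 > 0 \<longrightarrow>
        (if \<Delta>2 > 0
         then num_roots g (\<lambda>z. z = 0) = 1 \<and> num_roots g (\<lambda>z. Re z < 0) = 3
         else num_roots g (\<lambda>z. z = 0) = 1
            \<and> num_roots g (\<lambda>z. z \<in> \<real> \<and> Re z < 0) = 1
            \<and> num_roots g (\<lambda>z. z \<noteq> 0 \<and> Re z \<ge> 0) = 2))
   \<and> (poly g 0 = 0 \<and> poly (pderiv g) 0 = 0 \<longrightarrow>
        num_roots g (\<lambda>z. Re z < 0) = 2 \<and> num_roots g (\<lambda>z. z = 0) = 2)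
   \<and> (poly g 0 = 0 \<and> poly (pderiv g) 0 < 0 \<longrightarrow>
        num_roots g (\<lambda>z. z = 0) = 1
      \<and> num_roots g (\<lambda>z. z \<in> \<real> \<and> Re z > 0) = 1
      \<and> num_roots g (\<lambda>z. Re z < 0) = 2)
   \<and> (poly g 0 < 0 \<longrightarrow>
        (if \<Delta>2 < 0 \<and> \<Delta>3 < 0
         then num_roots g (\<lambda>z. z \<in> \<real> \<and> Re z < 0) = 1 \<and> num_roots g (\<lambda>z. Re z > 0) = 3
         else num_roots g (\<lambda>z. z \<in> \<real> \<and> Re z > 0) = 1 \<and> num_roots g (\<lambda>z. Re z \<le> 0) = 3))"
proof -
  define p q r s where "p = b1 + b2" and "q = c^2 * \<xi>^2 + b1 * b2"
    and "r = \<xi>^2 * (a1 + c^2 * b1 + a2 + c^2 * b2)"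
    and "s = \<xi>^2 * (c^2 * b1 * b2 + a1 * b2 + a2 * b1)"
  note defs = p_def q_def r_def s_def
  have p: "p > 0" and q: "q > 0"
    using \<open>b1 > 0\<close> \<open>b2 > 0\<close> by (simp_all add: defs add_nonneg_pos)
  have g: "g = [:s, r, q, p, 1:]"
    by (simp add: g g_poly_def defs)
  have g0: "poly g 0 = s" and g1: "poly (pderiv g) 0 = r"
    by (simp_all add: g pderiv_pCons)
  have D2: "\<Delta>2 = p * q - r"
    using \<Delta>2 by (simp add: Hurwitz2_def g_poly_def Let_def det_2 pderiv_pCons defs)
  have D3: "\<Delta>3 = p * q * r - p^2 * s - r^2"
    unfolding \<Delta>3 Hurwitz3_def Let_def det_3 g_poly_def
    by (simp add: pderiv_pCons defs power2_eq_square)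
  show ?thesis
    unfolding g0 g1 D2 D3
    using quartic_positive_constant[OF p, of s q r] quartic_negative_constant[OF p q, of s r]
      quartic_zero_constant_positive_linear[OF p q, of r] quartic_double_zero[OF p q]
      quartic_zero_constant_negative_linear[OF p q, of r]
    unfolding g by blast
qed

end
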